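(* Let $R$ be a ring. If $S$ is a multiplicative set of normal elements of $R$, then the set $\mathcal{F}=\{(s): s\in S\}$ is a strongly $r$-Oka family of ideals of $R$. Moreover, every ideal of $R$ is generated by a single normal element if and only if every prime ideal of $R$ is generated by a single normal element.
   Context: Rings are associative and unital, not necessarily commutative; "ideal" means two-sided ideal, and $(s)$ is the two-sided ideal generated by $s$. An element $x\in R$ is normal if $xR=Rx$ (in which case $xR=(x)=Rx$). A multiplicative set is a subset of $R$ containing $1$ and closed under multiplication. For ideals $I,J$ of $R$, $J^{-1}I=\{x\in R: Jx\subseteq I\}$. A family $\mathcal{F}$ of ideals of $R$ is strongly $r$-Oka if $R\in\mathcal{F}$ and, for all ideals $I,J$ of $R$, $I+J\in\mathcal{F}$ and $J^{-1}I\in\mathcal{F}$ imply $I\in\mathcal{F}$. *)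

theory Defs
  imports "HOL-Algebra.Algebra"
begin

definition normal_element :: "('a, 'b) ring_scheme \<Rightarrow> 'a \<Rightarrow> bool" where
  "normal_element R x \<longleftrightarrow>
     x \<in> carrier R \<and> x <#\<^bsub>R\<^esub> carrier R = carrier R #>\<^bsub>R\<^esub> x"

text \<open>The residual \<open>J\<inverse>I = {x \<in> R. J x \<subseteq> I}\<close>.\<close>

definition ideal_residual :: "('a, 'b) ring_scheme \<Rightarrow> 'a set \<Rightarrow> 'a set \<Rightarrow> 'a set" where
  "ideal_residual R J I = {x \<in> carrier R. J #>\<^bsub>R\<^esub> x \<subseteq> I}"

definition strongly_r_oka :: "('a, 'b) ring_scheme \<Rightarrow> 'a set set \<Rightarrow> bool" where
  "strongly_r_oka R \<F> \<longleftrightarrow>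
     (\<forall>I\<in>\<F>. ideal I R) \<and>
     carrier R \<in> \<F> \<and>
     (\<forall>I J. ideal I R \<longrightarrow> ideal J R \<longrightarrow>
        I <+>\<^bsub>R\<^esub> J \<in> \<F> \<longrightarrow> ideal_residual R J I \<in> \<F> \<longrightarrow> I \<in> \<F>)"

text \<open>Prime ideals of a not necessarily commutative ring. The library's locale
  \<open>primeideal\<close> presupposes commutativity and is elementwise (completely prime).\<close>

definition prime_ideal_nc :: "('a, 'b) ring_scheme \<Rightarrow> 'a set \<Rightarrow> bool" where
  "prime_ideal_nc R P \<longleftrightarrow>
     ideal P R \<and> P \<noteq> carrier R \<and>
     (\<forall>I J. ideal I R \<longrightarrow> ideal J R \<longrightarrow> I \<cdot>\<^bsub>R\<^esub> J \<subseteq> P \<longrightarrow> I \<subseteq> P \<or> J \<subseteq> P)"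

end

(* If I + J = sR = Rs and J^{-1}I = tR, then every element of I has the form s r with
   J r contained in Rsr, hence in I; so r lies in tR and I = stR, where st is again normal.
   For the second part, an ideal maximal outside an Oka family is prime, and by Zorn such an
   ideal exists if some ideal is not in the family: the union of a chain of ideals is not
   singly generated unless it is a member of the chain. *)

theory Submission
  imports Defs
begin

context ring
begin

section \<open>Products of normal elements and the ideals they generate\<close>

lemma normal_left_to_right:
  assumes "normal_element R x" "r \<in> carrier R"
  obtains q where "q \<in> carrier R" "x \<otimes> r = q \<otimes> x"
  using assms unfolding normal_element_def l_coset_def r_coset_def by blast

lemma normal_right_to_left:
  assumes "normal_element R x" "r \<in> carrier R"
  obtains q where "q \<in> carrier R" "r \<otimes> x = x \<otimes> q"
  using assms unfolding normal_element_def l_coset_def r_coset_def by blast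

lemma normal_element_closed: "normal_element R x \<Longrightarrow> x \<in> carrier R"
  by (simp add: normal_element_def)

lemma normal_element_one: "normal_element R \<one>"
  unfolding normal_element_def l_coset_def r_coset_def by auto

text \<open>A ring element moves past \<open>y\<close> and then past \<open>x\<close>, changing at
  each passage: \<open>x y r = x p y = q x y\<close>, and symmetrically from the other side.\<close>

lemma normal_element_mult:
  assumes x: "normal_element R x" and y: "normal_element R y"
  shows "normal_element R (x \<otimes> y)"
proof -
  note [simp] = x[THEN normal_element_closed] y[THEN normal_element_closed]
  have "\<exists>q\<in>carrier R. x \<otimes> y \<otimes> r = q \<otimes> (x \<otimes> y)" if r: "r \<in> carrier R" for r
  proof -
    obtain p where p: "p \<in> carrier R" "y \<otimes> r = p \<otimes> y"
      using normal_left_to_right[OF y r] .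
    obtain q where q: "q \<in> carrier R" "x \<otimes> p = q \<otimes> x"
      using normal_left_to_right[OF x p(1)] .
    have "x \<otimes> y \<otimes> r = (x \<otimes> p) \<otimes> y"
      using r p by (simp add: m_assoc)
    also have "\<dots> = q \<otimes> (x \<otimes> y)"
      using q by (simp add: m_assoc)
    finally show ?thesis
      using q(1) by blast
  qed
  moreover have "\<exists>q\<in>carrier R. r \<otimes> (x \<otimes> y) = x \<otimes> y \<otimes> q" if r: "r \<in> carrier R" for r
  proof -
    obtain p where p: "p \<in> carrier R" "r \<otimes> x = x \<otimes> p"
      using normal_right_to_left[OF x r] .
    obtain q where q: "q \<in> carrier R" "p \<otimes> y = y \<otimes> q"
      using normal_right_to_left[OF y p(1)] .
    have "r \<otimes> (x \<otimes> y) = x \<otimes> (p \<otimes> y)"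
      using r p by (simp flip: m_assoc)
    also have "\<dots> = x \<otimes> y \<otimes> q"
      using q by (simp add: m_assoc)
    finally show ?thesis
      using q(1) by blast
  qed
  ultimately show ?thesis
    unfolding normal_element_def l_coset_def r_coset_def by auto
qed

text \<open>The largest choice of multiplicative set in the first claim; with it the Oka family
  consists of all ideals generated by a normal element, as the second claim requires.\<close>

lemma submonoid_normal_elements: "submonoid {x. normal_element R x} R"
  by (rule submonoid.intro)
    (auto simp: normal_element_closed normal_element_mult normal_element_one)

text \<open>Since \<open>r x\<close> can be rewritten as \<open>x p\<close>, the right multiples of
  \<open>x\<close> absorb left multiplication as well. Membership in \<open>Idl {x}\<close> thereby
  becomes left divisibility by \<open>x\<close>.\<close>

lemma genideal_normal:
  assumes x: "normal_element R x"
  shows "Idl {x} = x <# carrier R"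
proof
  note [simp] = x[THEN normal_element_closed]
  have "ideal (x <# carrier R) R"
  proof (rule idealI[OF ring_axioms])
    show "subgroup (x <# carrier R) (add_monoid R)"
    proof (rule add.subgroupI)
      show "x <# carrier R \<subseteq> carrier R" "x <# carrier R \<noteq> {}"
        by (auto simp: l_coset_def)
    next
      fix a assume "a \<in> x <# carrier R"
      then obtain r where "r \<in> carrier R" "a = x \<otimes> r"
        by (auto simp: l_coset_def)
      then have "\<ominus> r \<in> carrier R" "\<ominus> a = x \<otimes> \<ominus> r"
        by (simp_all add: r_minus)
      then show "\<ominus> a \<in> x <# carrier R"
        by (auto simp: l_coset_def)
    next
      fix a b assume "a \<in> x <# carrier R" "b \<in> x <# carrier R"
      then obtain r q where "r \<in> carrier R" "q \<in> carrier R" "a = x \<otimes> r" "b = x \<otimes> q"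
        by (auto simp: l_coset_def)
      then have "r \<oplus> q \<in> carrier R" "a \<oplus> b = x \<otimes> (r \<oplus> q)"
        by (simp_all add: r_distr)
      then show "a \<oplus> b \<in> x <# carrier R"
        by (auto simp: l_coset_def)
    qed
  next
    fix a r assume "a \<in> x <# carrier R" and r: "r \<in> carrier R"
    then obtain q where q: "q \<in> carrier R" "a = x \<otimes> q"
      by (auto simp: l_coset_def)
    have "q \<otimes> r \<in> carrier R" "a \<otimes> r = x \<otimes> (q \<otimes> r)"
      using q r by (simp_all add: m_assoc)
    then show "a \<otimes> r \<in> x <# carrier R"
      by (auto simp: l_coset_def)
    obtain p where p: "p \<in> carrier R" "r \<otimes> x = x \<otimes> p"
      using normal_right_to_left[OF x r] .
    have "r \<otimes> a = (r \<otimes> x) \<otimes> q"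
      using q r by (simp add: m_assoc)
    also have "\<dots> = x \<otimes> (p \<otimes> q)"
      using p q by (simp add: m_assoc)
    finally show "r \<otimes> a \<in> x <# carrier R"
      using p q by (auto simp: l_coset_def)
  qed
  moreover have "x \<in> x <# carrier R"
    using one_closed r_one[of x] by (force simp: l_coset_def)
  ultimately show "Idl {x} \<subseteq> x <# carrier R"
    by (simp add: genideal_minimal)
next
  interpret ideal "Idl {x}" R
    using x by (simp add: genideal_ideal normal_element_closed)
  show "x <# carrier R \<subseteq> Idl {x}"
    using x by (auto simp: l_coset_def I_r_closed genideal_self' normal_element_closed)
qed

section \<open>Residuals, sums of ideals and the Oka condition\<close>

lemma mem_ideal_residual:
  "x \<in> ideal_residual R J I \<longleftrightarrow> x \<in> carrier R \<and> (\<forall>j\<in>J. j \<otimes> x \<in> I)"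
  by (auto simp: ideal_residual_def r_coset_def)

text \<open>Absorption on the left comes from \<open>J\<close>, as \<open>j (x a) = (j x) a\<close>
  with \<open>j x\<close> in \<open>J\<close>; absorption on the right comes from \<open>I\<close>,
  as \<open>j (a x) = (j a) x\<close>.\<close>

lemma ideal_residual_is_ideal:
  assumes "ideal I R" "ideal J R"
  shows "ideal (ideal_residual R J I) R"
proof -
  interpret I: ideal I R by fact
  interpret J: ideal J R by fact
  show ?thesis
  proof (rule idealI[OF ring_axioms])
    show "subgroup (ideal_residual R J I) (add_monoid R)"
    proof (rule add.subgroupI)
      show "ideal_residual R J I \<subseteq> carrier R"
        by (auto simp: mem_ideal_residual)
      have "\<zero> \<in> ideal_residual R J I"
        by (auto simp: mem_ideal_residual J.Icarr)
      then show "ideal_residual R J I \<noteq> {}"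
        by blast
    qed (auto simp: mem_ideal_residual J.Icarr r_minus r_distr)
  next
    fix a x assume a: "a \<in> ideal_residual R J I" and x: "x \<in> carrier R"
    show "x \<otimes> a \<in> ideal_residual R J I"
      using a x by (auto simp: mem_ideal_residual J.Icarr J.I_r_closed simp flip: m_assoc)
    show "a \<otimes> x \<in> ideal_residual R J I"
      using a x by (auto simp: mem_ideal_residual J.Icarr I.I_r_closed simp flip: m_assoc)
  qed
qed

lemma subset_set_add:
  assumes "ideal I R" "ideal J R"
  shows "I \<subseteq> I <+>\<^bsub>R\<^esub> J" "J \<subseteq> I <+>\<^bsub>R\<^esub> J"
  using union_genideal[OF assms] genideal_self[of "I \<union> J"] assms
  by (auto dest: ideal.Icarr)

text \<open>Dividing an element of \<open>I\<close> by \<open>s\<close> on the left leaves a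
  quotient in the residual, which is divisible by \<open>t\<close> in turn; this fixes the order of
  the factors in \<open>s \<otimes> t\<close>.\<close>

lemma ideal_eq_genideal_mult:
  assumes I: "ideal I R" and J: "ideal J R"
    and s: "normal_element R s" "I <+>\<^bsub>R\<^esub> J = Idl {s}"
    and t: "normal_element R t" "ideal_residual R J I = Idl {t}"
  shows "I = Idl {s \<otimes> t}"
proof
  interpret I: ideal I R by fact
  interpret J: ideal J R by fact
  note [simp] = s(1)[THEN normal_element_closed] t(1)[THEN normal_element_closed]
  show "I \<subseteq> Idl {s \<otimes> t}"
  proof
    fix x assume x: "x \<in> I"
    then have "x \<in> s <# carrier R"
      using subset_set_add(1)[OF I J] s by (auto simp: genideal_normal)
    then obtain r where r: "r \<in> carrier R" "x = s \<otimes> r"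
      by (auto simp: l_coset_def)
    have "j \<otimes> r \<in> I" if "j \<in> J" for j
    proof -
      have "j \<in> s <# carrier R"
        using that subset_set_add(2)[OF I J] s by (auto simp: genideal_normal)
      \<comment> \<open>Normality moves \<open>s\<close> to the right of \<open>j\<close>, where it
        meets \<open>r\<close>: \<open>j r = q s r = q x\<close>.\<close>
      then obtain q where q: "q \<in> carrier R" "j = q \<otimes> s"
        using s(1) by (auto simp: normal_element_def r_coset_def)
      then have "j \<otimes> r = q \<otimes> x"
        using r by (simp add: m_assoc)
      then show ?thesis
        using q x by (simp add: I.I_l_closed)
    qed
    then have "r \<in> ideal_residual R J I"
      using r by (simp add: mem_ideal_residual)
    then have "r \<in> t <# carrier R"
      using t by (simp add: genideal_normal)
    then obtain u where "u \<in> carrier R" "x = (s \<otimes> t) \<otimes> u"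
      using r by (auto simp: l_coset_def m_assoc)
    then show "x \<in> Idl {s \<otimes> t}"
      using s t by (auto simp: genideal_normal normal_element_mult l_coset_def)
  qed
  \<comment> \<open>For the reverse inclusion, split \<open>s = i + j\<close>. Then
    \<open>s t = i t + j t\<close>, where \<open>i t\<close> is in \<open>I\<close> because
    \<open>I\<close> is an ideal and \<open>j t\<close> because \<open>t\<close> is in the
    residual.\<close>
  have "s \<in> I <+>\<^bsub>R\<^esub> J"
    using s by (simp add: genideal_self')
  then obtain i j where ij: "i \<in> I" "j \<in> J" "s = i \<oplus> j"
    by (auto simp: set_add_def')
  have "t \<in> ideal_residual R J I"
    using t by (simp add: genideal_self')
  then have "j \<otimes> t \<in> I"
    using ij by (simp add: mem_ideal_residual)
  then have "s \<otimes> t \<in> I"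
    using ij by (simp add: l_distr I.I_r_closed I.Icarr J.Icarr)
  then show "Idl {s \<otimes> t} \<subseteq> I"
    by (simp add: genideal_minimal I)
qed

text \<open>The two submonoid laws match the two Oka conditions: \<open>\<one>\<close> generates the
  whole ring, and the product of the generators of the sum and the residual stays in
  \<open>S\<close> and generates \<open>I\<close>.\<close>

proposition strongly_r_oka_normal:
  assumes S: "submonoid S R" and normal: "\<And>s. s \<in> S \<Longrightarrow> normal_element R s"
  shows "strongly_r_oka R {Idl {s} |s. s \<in> S}"
  unfolding strongly_r_oka_def
proof (intro conjI allI impI)
  interpret S: submonoid S R by fact
  show "\<forall>I\<in>{Idl {s} |s. s \<in> S}. ideal I R"
    using S.subset by (auto intro: genideal_ideal)
  show "carrier R \<in> {Idl {s} |s. s \<in> S}"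
    using genideal_one by force
  fix I J assume "ideal I R" "ideal J R"
    and "I <+>\<^bsub>R\<^esub> J \<in> {Idl {s} |s. s \<in> S}" "ideal_residual R J I \<in> {Idl {s} |s. s \<in> S}"
  then show "I \<in> {Idl {s} |s. s \<in> S}"
    using ideal_eq_genideal_mult normal by blast
qed

section \<open>Maximal non-members of a family and prime ideals\<close>

text \<open>If \<open>A B\<close> lies in \<open>P\<close> but neither factor does, then
  \<open>P + A\<close> and the residual of \<open>P\<close> by \<open>P + A\<close> both properly
  contain \<open>P\<close>. Maximality puts both in the family, and the Oka condition then forces
  \<open>P\<close> in too.\<close>

lemma strongly_r_oka_maximal_prime:
  assumes oka: "strongly_r_oka R \<F>" and P: "ideal P R" "P \<notin> \<F>"
    and maximal: "\<And>I. ideal I R \<Longrightarrow> P \<subset> I \<Longrightarrow> I \<in> \<F>"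
  shows "prime_ideal_nc R P"
  unfolding prime_ideal_nc_def
proof (intro conjI allI impI)
  interpret P: ideal P R by fact
  show "ideal P R" by fact
  show "P \<noteq> carrier R"
    using oka P(2) unfolding strongly_r_oka_def by blast
  fix A B assume A: "ideal A R" and B: "ideal B R" and AB: "A \<cdot> B \<subseteq> P"
  interpret A: ideal A R by fact
  interpret B: ideal B R by fact
  show "A \<subseteq> P \<or> B \<subseteq> P"
  proof (rule ccontr)
    assume not_le: "\<not> (A \<subseteq> P \<or> B \<subseteq> P)"
    have PA: "ideal (P <+>\<^bsub>R\<^esub> A) R"
      using P A by (simp add: add_ideals)
    \<comment> \<open>The Oka condition is applied to \<open>P\<close> and \<open>P + A\<close>, so
      the sum occurring in it has to be reduced to \<open>P + A\<close>.\<close>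
    have "P <+>\<^bsub>R\<^esub> (P <+>\<^bsub>R\<^esub> A) = P <+>\<^bsub>R\<^esub> A"
    proof
      show "P <+>\<^bsub>R\<^esub> (P <+>\<^bsub>R\<^esub> A) \<subseteq> P <+>\<^bsub>R\<^esub> A"
      proof
        fix x assume "x \<in> P <+>\<^bsub>R\<^esub> (P <+>\<^bsub>R\<^esub> A)"
        then obtain p y where "p \<in> P" "y \<in> P <+>\<^bsub>R\<^esub> A" "x = p \<oplus> y"
          by (auto simp: set_add_def')
        then show "x \<in> P <+>\<^bsub>R\<^esub> A"
          using subset_set_add(1)[OF P(1) A] PA
          by (auto intro: additive_subgroup.a_closed ideal.axioms(1))
      qed
    qed (rule subset_set_add(2)[OF P(1) PA])
    moreover have "P \<subset> (P <+>\<^bsub>R\<^esub> A)"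
      using subset_set_add[OF P(1) A] not_le by blast
    ultimately have sum: "P <+>\<^bsub>R\<^esub> (P <+>\<^bsub>R\<^esub> A) \<in> \<F>"
      using maximal PA by simp
    let ?Q = "ideal_residual R (P <+>\<^bsub>R\<^esub> A) P"
    have "P \<subseteq> ?Q"
      using ideal.Icarr[OF PA] by (auto simp: mem_ideal_residual P.Icarr P.I_l_closed)
    \<comment> \<open>For \<open>b\<close> in \<open>B\<close>, \<open>(p + a) b = p b + a b\<close>
      lies in \<open>P + A B\<close>, hence in \<open>P\<close>. As \<open>B\<close> is not
      contained in \<open>P\<close>, the residual is strictly larger than \<open>P\<close>.\<close>
    moreover have "B \<subseteq> ?Q"
    proof
      fix b assume b: "b \<in> B"
      have "x \<otimes> b \<in> P" if "x \<in> P <+>\<^bsub>R\<^esub> A" for x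
      proof -
        obtain p a where x: "p \<in> P" "a \<in> A" "x = p \<oplus> a"
          using \<open>x \<in> P <+>\<^bsub>R\<^esub> A\<close> by (auto simp: set_add_def')
        have "a \<otimes> b \<in> P"
          using ideal_prod.prod[OF x(2) b] AB by blast
        then show ?thesis
          using x b by (simp add: l_distr P.I_r_closed P.Icarr A.Icarr B.Icarr)
      qed
      then show "b \<in> ?Q"
        using b by (simp add: mem_ideal_residual B.Icarr)
    qed
    ultimately have "?Q \<in> \<F>"
      using maximal ideal_residual_is_ideal[OF P(1) PA] not_le by blast
    then show False
      using oka P PA sum unfolding strongly_r_oka_def by blast
  qed
qed

text \<open>Principality of the members lets Zorn's lemma apply to the ideals outside the family: a
  single generator of a union already lies in one ideal of the chain.\<close>

lemma ex_maximal_ideal_not_in_family: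
  assumes principal: "\<And>J. J \<in> \<F> \<Longrightarrow> \<exists>x\<in>carrier R. J = Idl {x}"
    and I: "ideal I R" "I \<notin> \<F>"
  obtains P where "ideal P R" "P \<notin> \<F>" "\<And>J. ideal J R \<Longrightarrow> P \<subset> J \<Longrightarrow> J \<in> \<F>"
proof -
  define \<A> where "\<A> = {J. ideal J R \<and> J \<notin> \<F>}"
  have "\<exists>P\<in>\<A>. \<forall>J\<in>\<A>. P \<subseteq> J \<longrightarrow> J = P"
  \<comment> \<open>This form asks for bounds of nonempty chains only; the union of the empty chain
    is the empty set, which is not an ideal.\<close>
  proof (rule subset_Zorn_nonempty)
    show "\<A> \<noteq> {}"
      using I by (auto simp: \<A>_def)
    fix C assume C: "C \<noteq> {}" "subset.chain \<A> C"
    then have "subset.chain {J. ideal J R} C"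
      by (auto simp: subset_chain_def \<A>_def)
    then have ideal: "ideal (\<Union>C) R"
      using chain_Union_is_ideal[of C] C(1) by simp
    have "\<Union>C \<notin> \<F>"
    proof
      assume U: "\<Union>C \<in> \<F>"
      then obtain x where x: "x \<in> carrier R" "\<Union>C = Idl {x}"
        using principal by blast
      \<comment> \<open>An ideal \<open>J\<close> of the chain that contains the generator
        \<open>x\<close> is the whole union, so the union cannot be in the family while
        \<open>J\<close> is outside it.\<close>
      then obtain J where J: "J \<in> C" "x \<in> J"
        using genideal_self'[of x] by blast
      have J': "ideal J R" "J \<notin> \<F>"
        using J C(2) by (auto simp: subset_chain_def \<A>_def)
      then have "\<Union>C \<subseteq> J"
        using x J by (simp add: genideal_minimal)
      then show False
        using U J(1) J'(2) by (metis Union_upper subset_antisym)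
    qed
    with ideal show "\<Union>C \<in> \<A>"
      by (simp add: \<A>_def)
  qed
  then show thesis
    using that unfolding \<A>_def by blast
qed

text \<open>A counterexample \<open>I\<close> yields a maximal one \<open>P\<close>, which is prime
  by the Oka property and thus contradicts the hypothesis on primes.\<close>

proposition all_normal_if_prime_normal:
  assumes prime: "\<And>P. prime_ideal_nc R P \<Longrightarrow> \<exists>x. normal_element R x \<and> P = Idl {x}"
    and I: "ideal I R"
  shows "\<exists>x. normal_element R x \<and> I = Idl {x}"
proof (rule ccontr)
  let ?F = "{Idl {x} |x. normal_element R x}"
  assume "\<not> ?thesis"
  then have not_in: "I \<notin> ?F"
    by blast
  have principal: "\<exists>x\<in>carrier R. J = Idl {x}" if "J \<in> ?F" for J
    using that normal_element_closed by blast
  obtain P where P: "ideal P R" "P \<notin> ?F" "\<And>J. ideal J R \<Longrightarrow> P \<subset> J \<Longrightarrow> J \<in> ?F"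
    using ex_maximal_ideal_not_in_family[OF principal I not_in] by blast
  have "strongly_r_oka R ?F"
    using strongly_r_oka_normal[OF submonoid_normal_elements] by simp
  then have "prime_ideal_nc R P"
    using P by (rule strongly_r_oka_maximal_prime)
  then show False
    using prime P(2) by blast
qed

end

theorem proposition4p1:
  fixes R :: "('a, 'b) ring_scheme"
  assumes "ring R"
  shows "(\<forall>S. submonoid S R \<and> (\<forall>s\<in>S. normal_element R s) \<longrightarrow>
            strongly_r_oka R {Idl\<^bsub>R\<^esub> {s} | s. s \<in> S}) \<and>
         ((\<forall>I. ideal I R \<longrightarrow> (\<exists>x. normal_element R x \<and> I = Idl\<^bsub>R\<^esub> {x})) \<longleftrightarrow>
          (\<forall>P. prime_ideal_nc R P \<longrightarrow> (\<exists>x. normal_element R x \<and> P = Idl\<^bsub>R\<^esub> {x})))"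
proof -
  interpret ring R by fact
  show ?thesis
  proof (intro conjI allI impI iffI)
    fix S assume "submonoid S R \<and> (\<forall>s\<in>S. normal_element R s)"
    then show "strongly_r_oka R {Idl\<^bsub>R\<^esub> {s} |s. s \<in> S}"
      by (intro strongly_r_oka_normal) auto
  next
    fix P assume "\<forall>I. ideal I R \<longrightarrow> (\<exists>x. normal_element R x \<and> I = Idl\<^bsub>R\<^esub> {x})"
      and "prime_ideal_nc R P"
    then show "\<exists>x. normal_element R x \<and> P = Idl\<^bsub>R\<^esub> {x}"
      unfolding prime_ideal_nc_def by blast
  next
    fix I assume "\<forall>P. prime_ideal_nc R P \<longrightarrow> (\<exists>x. normal_element R x \<and> P = Idl\<^bsub>R\<^esub> {x})"
      and "ideal I R"
    then show "\<exists>x. normal_element R x \<and> I = Idl\<^bsub>R\<^esub> {x}"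
      using all_normal_if_prime_normal by blast
  qed
qed

end
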